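(* Let $A$ and $B$ be Archimedean semiprime $f$-algebras such that $B$ is relatively uniformly complete, and let $T:A\to B$ be a contractive operator. Then $T$ is an extreme point in the collection of all contractive operators from $A$ to $B$ if and only if $\overline{T}$ is an extreme point in the collection of all contractive operators from $\overline{A}$ to $B$.
   Context: All spaces are real. A Riesz algebra is a Riesz space with an associative algebra multiplication such that products of positive elements are positive. It is an $f$-algebra if $a\wedge b=0$ implies $ac\wedge b=ca\wedge b=0$ for all $c\ge 0$. An $f$-algebra is semiprime if $0$ is its only nilpotent element. For an Archimedean semiprime $f$-algebra $A$, $\mathrm{Orth}(A)$ denotes the $f$-algebra of orthomorphisms of $A$, with identity operator $I_A$. $A$ is identified with its image in $\mathrm{Orth}(A)$ under the injective $f$-algebra homomorphism $a\mapsto\pi_a$, $\pi_a(b)=ab$. Thus $A\cap[0,I_A]$ is the set of $0\le a\in A$ with $ab\le b$ for all $0\le b\in A$. A positive linear operator $T:A\to B$ between Archimedean semiprime $f$-algebras is contractive if $Ta\in B\cap[0,I_B]$ whenever $a\in A\cap[0,I_A]$. A Riesz space is relatively uniformly complete if every relatively uniformly Cauchy sequence converges relatively uniformly. For Archimedean $A$, the relatively uniform completion $\overline{A}$ is the closure of $A$, in its Dedekind completion, with respect to the relatively uniform topology (whose closed sets are those containing all limits of their relatively uniformly convergent sequences). For an Archimedean semiprime $f$-algebra $A$ the multiplication extends uniquely to a lattice ordered algebra multiplication on $\overline{A}$ such that $A$ is a subalgebra of $\overline A$ and $\overline{A}$ is a relatively uniformly complete semiprime $f$-algebra. For a positive linear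 operator $T:A\to B$ into a relatively uniformly complete $B$, $\overline{T}:\overline{A}\to B$ is its unique positive linear extension, given by $\overline{T}(x)=\sup\{T(a):a\in A,\ 0\le a\le x\}$ for $0\le x\in\overline{A}$. *)

theory Defs
  imports
    "HOL-Analysis.Analysis"
    "HOL-Library.Function_Algebras"
    "HOL-Library.Lattice_Algebras"
begin

section \<open>Riesz spaces and relatively uniform convergence\<close>

text \<open>\<open>\<bar>x\<bar>\<close> is fixed by the axioms of \<^class>\<open>lattice_ab_group_add_abs\<close> to be \<open>sup x (- x)\<close>.\<close>

class riesz_space = ordered_real_vector + lattice_ab_group_add_abs
begin

definition ru_tendsto :: "(nat \<Rightarrow> 'a) \<Rightarrow> 'a \<Rightarrow> bool" where
  "ru_tendsto f x \<longleftrightarrow>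
    (\<exists>u\<ge>0. \<forall>\<epsilon>>0. \<exists>N. \<forall>n\<ge>N. \<bar>f n - x\<bar> \<le> \<epsilon> *\<^sub>R u)"

definition ru_Cauchy :: "(nat \<Rightarrow> 'a) \<Rightarrow> bool" where
  "ru_Cauchy f \<longleftrightarrow>
    (\<exists>u\<ge>0. \<forall>\<epsilon>>0. \<exists>N. \<forall>m\<ge>N. \<forall>n\<ge>N. \<bar>f m - f n\<bar> \<le> \<epsilon> *\<^sub>R u)"

definition ru_closed :: "'a set \<Rightarrow> bool" where
  "ru_closed S \<longleftrightarrow> (\<forall>f x. (\<forall>n. f n \<in> S) \<and> ru_tendsto f x \<longrightarrow> x \<in> S)"

text \<open>Topological closure for the relatively uniform topology; in general this is larger than the
  set of limits of relatively uniformly convergent sequences in \<open>S\<close>.\<close>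

definition ru_closure :: "'a set \<Rightarrow> 'a set" where
  "ru_closure S = \<Inter>{C. S \<subseteq> C \<and> ru_closed C}"

end

class archimedean_riesz_space = riesz_space +
  assumes archimedean: "0 \<le> x \<Longrightarrow> (\<And>n::nat. of_nat n *\<^sub>R x \<le> y) \<Longrightarrow> x = 0"

class ru_complete_riesz_space = riesz_space +
  assumes ru_complete: "ru_Cauchy f \<Longrightarrow> \<exists>x. ru_tendsto f x"

class dedekind_complete_riesz_space = riesz_space + conditionally_complete_lattice

definition riesz_embedding :: "('a::riesz_space \<Rightarrow> 'b::riesz_space) \<Rightarrow> bool" where
  "riesz_embedding h \<longleftrightarrow>
    linear h \<and> inj h \<and>
    (\<forall>x y. h (sup x y) = sup (h x) (h y)) \<and> (\<forall>x y. h (inf x y) = inf (h x) (h y))"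

text \<open>The type \<open>'d\<close> is a Dedekind completion of \<open>'a\<close> when \<open>'a\<close> embeds in it as an order dense,
  majorizing Riesz subspace; this determines \<open>'d\<close> up to a unique Riesz isomorphism over \<open>'a\<close>.\<close>

definition dedekind_completion ::
    "('a::riesz_space \<Rightarrow> 'd::dedekind_complete_riesz_space) \<Rightarrow> bool" where
  "dedekind_completion k \<longleftrightarrow>
    riesz_embedding k \<and> (\<forall>d>0. \<exists>a. 0 < k a \<and> k a \<le> d) \<and> (\<forall>d. \<exists>a. d \<le> k a)"


section \<open>\<open>f\<close>-algebras\<close>

class riesz_algebra = riesz_space + lattice_ring + real_algebra

class f_algebra = riesz_algebra +
  assumes inf_mult_right_eq_0: "inf a b = 0 \<Longrightarrow> 0 \<le> c \<Longrightarrow> inf (a * c) b = 0"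
    and inf_mult_left_eq_0: "inf a b = 0 \<Longrightarrow> 0 \<le> c \<Longrightarrow> inf (c * a) b = 0"

text \<open>There need not be a unit, so \<open>((*) a ^^ n) a\<close> is used for the power of \<open>a\<close> with exponent
  \<open>n + 1\<close>.\<close>

class semiprime_f_algebra = f_algebra +
  assumes semiprime: "((*) a ^^ n) a = 0 \<Longrightarrow> a = 0"

class archimedean_semiprime_f_algebra = semiprime_f_algebra + archimedean_riesz_space

text \<open>The set \<open>A \<inter> [0, I]\<close>, where \<open>a \<in> A\<close> is identified with the orthomorphism \<open>\<lambda>b. a * b\<close>
  and orthomorphisms are ordered pointwise on the positive cone.\<close>

definition subunits :: "'a::archimedean_semiprime_f_algebra set" where
  "subunits = {a. 0 \<le> a \<and> (\<forall>b\<ge>0. a * b \<le> b)}"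


section \<open>Positive and contractive operators\<close>

definition positive_operator :: "('a::riesz_space \<Rightarrow> 'b::riesz_space) \<Rightarrow> bool" where
  "positive_operator T \<longleftrightarrow> linear T \<and> (\<forall>x\<ge>0. 0 \<le> T x)"

definition contractive_operator ::
    "('a::archimedean_semiprime_f_algebra \<Rightarrow> 'b::archimedean_semiprime_f_algebra) \<Rightarrow> bool" where
  "contractive_operator T \<longleftrightarrow> positive_operator T \<and> (\<forall>a\<in>subunits. T a \<in> subunits)"

text \<open>The pointwise vector space structure on functions makes \<^const>\<open>extreme_point_of\<close>
  applicable to sets of operators.\<close>

instantiation "fun" :: (type, real_vector) real_vector
begin

definition scaleR_fun :: "real \<Rightarrow> ('a \<Rightarrow> 'b) \<Rightarrow> 'a \<Rightarrow> 'b" where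
  "scaleR_fun r f = (\<lambda>x. r *\<^sub>R f x)"

instance
  by standard (simp_all add: scaleR_fun_def fun_eq_iff plus_fun_def scaleR_add_right scaleR_add_left)

end


section \<open>Relatively uniform completion\<close>

text \<open>The algebra \<open>'c\<close>, with \<open>j\<close> as the inclusion of \<open>'a\<close>, is the relatively uniform completion of
  \<open>'a\<close>: via \<open>e\<close> it is identified, as a Riesz space, with the relatively uniform closure of \<open>'a\<close> in a
  Dedekind completion \<open>'d\<close> of \<open>'a\<close>, and its multiplication extends that of \<open>'a\<close>. That \<open>j\<close> is a Riesz
  embedding follows, since both \<open>e \<circ> j\<close> and \<open>e\<close> are.\<close>

definition ru_completion ::
    "('a::archimedean_semiprime_f_algebra \<Rightarrow> 'c::archimedean_semiprime_f_algebra) \<Rightarrow>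
     ('c \<Rightarrow> 'd::dedekind_complete_riesz_space) \<Rightarrow> bool" where
  "ru_completion j e \<longleftrightarrow>
    dedekind_completion (e \<circ> j) \<and>
    riesz_embedding e \<and> range e = ru_closure (range (e \<circ> j)) \<and>
    (\<forall>a b. j (a * b) = j a * j b)"

text \<open>When \<open>j\<close> is the inclusion into the relatively uniform completion and \<open>'b\<close> is Archimedean and
  relatively uniformly complete, every positive \<open>T\<close> has exactly one positive linear extension, and
  for \<open>x \<ge> 0\<close> its value at \<open>x\<close> is the supremum of all \<open>T a\<close> with \<open>0 \<le> j a \<le> x\<close>.\<close>

definition ru_extension ::
    "('a::riesz_space \<Rightarrow> 'c::riesz_space) \<Rightarrow> ('a \<Rightarrow> 'b::riesz_space) \<Rightarrow> 'c \<Rightarrow> 'b" where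
  "ru_extension j T = (THE S. positive_operator S \<and> (\<forall>a. S (j a) = T a))"

end

theory Submission
  imports Defs
begin

text \<open>Restriction \<open>S \<mapsto> S \<circ> j\<close> is a linear map between the spaces of operators. The theorem holds because
  it maps the contractive operators on the completion bijectively onto the contractive operators on
  the original algebra, and its inverse is \<open>T \<mapsto> ru_extension j T\<close>; extreme points are preserved by
  such a map. The bijection rests on three facts.

  The first is that a positive operator \<open>T\<close> has exactly one positive extension
  (\<open>ex1_positive_extension\<close>). Write \<open>k = e \<circ> j\<close>. A positive extension must take at \<open>x\<close> a value between
  \<open>sup {T a | k a \<le> e x}\<close> and \<open>inf {T a | e x \<le> k a}\<close>. Say that \<open>d\<close>, an element of the Dedekind
  completion, is squeezed if this supremum and this infimum, formed with \<open>d\<close> instead of \<open>e x\<close>, exist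
  and agree. The squeezed elements contain the range of \<open>k\<close>, and they form a relatively uniformly
  closed set because the target is relatively uniformly complete (\<open>ru_closed_squeezed\<close>). So they contain
  the relatively uniform closure of the range of \<open>k\<close>, and no iteration of limits is necessary. The
  common value is additive because the supremum is superadditive and the infimum is subadditive.

  The second is that the inclusion \<open>j\<close> maps subunits to subunits (\<open>ru_completion_subunits\<close>), so that
  restrictions of contractive operators are contractive. The third is that the extension of a
  contractive operator is contractive (\<open>contractive_operator_extend\<close>). Both pass an inequality
  \<open>a * b \<le> b\<close> to a supremum, in \<open>b\<close> and in \<open>a\<close> respectively, and therefore follow from the order
  continuity of multiplications. This continuity (\<open>positive_orthomorphism_lub\<close>) is a consequence of
  the estimate \<open>\<pi> w \<le> w / t + t \<pi>\<^sup>2 w\<close>, which holds for every positive orthomorphism \<open>\<pi>\<close>, every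
  \<open>w \<ge> 0\<close> and every real \<open>t > 0\<close>.\<close>

section \<open>Archimedean estimates\<close>

lemma archimedean_le_0:
  fixes x u :: "'a::archimedean_riesz_space"
  assumes "\<And>\<epsilon>. \<epsilon> > 0 \<Longrightarrow> x \<le> \<epsilon> *\<^sub>R u"
  shows "x \<le> 0"
proof -
  have "of_nat n *\<^sub>R sup x 0 \<le> sup u 0" for n :: nat
  proof (cases "n = 0")
    case False
    then have n: "0 < real n" by simp
    have "x \<le> (1 / real n) *\<^sub>R u" using n by (intro assms) simp
    also have "\<dots> \<le> (1 / real n) *\<^sub>R sup u 0"
      by (intro scaleR_left_mono) auto
    finally have "sup x 0 \<le> (1 / real n) *\<^sub>R sup u 0"
      by (intro sup_least) (auto intro: scaleR_nonneg_nonneg)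
    then have "real n *\<^sub>R sup x 0 \<le> real n *\<^sub>R ((1 / real n) *\<^sub>R sup u 0)"
      by (intro scaleR_left_mono) auto
    then show ?thesis using n by simp
  qed simp
  then have "sup x 0 = 0" by (intro archimedean[of "sup x 0" "sup u 0"]) auto
  then show ?thesis by (metis sup.cobounded1)
qed

lemma archimedean_leI:
  fixes x y u :: "'a::archimedean_riesz_space"
  assumes "\<And>\<epsilon>. \<epsilon> > 0 \<Longrightarrow> x \<le> y + \<epsilon> *\<^sub>R u"
  shows "x \<le> y"
  using archimedean_le_0[of "x - y" u] assms by (simp add: algebra_simps)

lemma ru_tendsto_bounds:
  assumes "ru_tendsto f x"
  obtains u where "0 \<le> u"
    "\<And>\<epsilon>. \<epsilon> > 0 \<Longrightarrow> \<exists>N. \<forall>n\<ge>N. f n \<le> x + \<epsilon> *\<^sub>R u \<and> x \<le> f n + \<epsilon> *\<^sub>R u"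
proof -
  obtain u where "0 \<le> u" and u: "\<And>\<epsilon>. \<epsilon> > 0 \<Longrightarrow> \<exists>N. \<forall>n\<ge>N. \<bar>f n - x\<bar> \<le> \<epsilon> *\<^sub>R u"
    using assms unfolding ru_tendsto_def by blast
  have "f n \<le> x + \<epsilon> *\<^sub>R u \<and> x \<le> f n + \<epsilon> *\<^sub>R u" if "\<bar>f n - x\<bar> \<le> \<epsilon> *\<^sub>R u" for n \<epsilon>
    using abs_le_D1[OF that] abs_le_D2[OF that] by (simp add: algebra_simps)
  with \<open>0 \<le> u\<close> u show thesis by (intro that) blast+
qed

section \<open>Order continuity of positive orthomorphisms\<close>

definition is_lub :: "'a::order set \<Rightarrow> 'a \<Rightarrow> bool" where
  "is_lub X c \<longleftrightarrow> (\<forall>z. c \<le> z \<longleftrightarrow> (\<forall>x\<in>X. x \<le> z))"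

definition positive_orthomorphism :: "('a::riesz_space \<Rightarrow> 'a) \<Rightarrow> bool" where
  "positive_orthomorphism \<pi> \<longleftrightarrow>
    positive_operator \<pi> \<and> (\<forall>x y. inf x y = 0 \<longrightarrow> inf (\<pi> x) y = 0)"

lemma positive_operator_mono:
  assumes "positive_operator T" "x \<le> y"
  shows "T x \<le> T y"
proof -
  have "0 \<le> T (y - x)" using assms by (simp add: positive_operator_def)
  then show ?thesis using assms by (simp add: positive_operator_def linear_diff)
qed

lemma positive_orthomorphism_mult_right:
  fixes b :: "'a::f_algebra"
  assumes "0 \<le> b"
  shows "positive_orthomorphism (\<lambda>x. x * b)"
  using assms inf_mult_right_eq_0
  by (auto simp: positive_orthomorphism_def positive_operator_def distrib_right intro!: linearI)

lemma positive_orthomorphism_mult_left: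
  fixes a :: "'a::f_algebra"
  assumes "0 \<le> a"
  shows "positive_orthomorphism (\<lambda>x. a * x)"
  using assms inf_mult_left_eq_0
  by (auto simp: positive_orthomorphism_def positive_operator_def distrib_left intro!: linearI)

text \<open>Rescaling \<open>inf (t p) g\<close> by \<open>1 / s\<close> with \<open>s = max t 1\<close> places it below both \<open>p\<close> and \<open>g\<close>.\<close>

lemma inf_scaleR_eq_0:
  fixes p g :: "'a::riesz_space"
  assumes pg: "inf p g = 0" and p: "0 \<le> p" and g: "0 \<le> g" and t: "t > 0"
  shows "inf (t *\<^sub>R p) g = 0"
proof -
  define x s where "x = inf (t *\<^sub>R p) g" and "s = max t 1"
  have s: "t \<le> s" "1 \<le> s" by (simp_all add: s_def)
  have x0: "0 \<le> x" unfolding x_def using p g t by (intro inf_greatest scaleR_nonneg_nonneg) auto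
  have "x \<le> t *\<^sub>R p" unfolding x_def by (rule inf.cobounded1)
  also have "\<dots> \<le> s *\<^sub>R p" using s p by (intro scaleR_right_mono)
  finally have "(1 / s) *\<^sub>R x \<le> (1 / s) *\<^sub>R s *\<^sub>R p" using s by (intro scaleR_left_mono) auto
  then have "(1 / s) *\<^sub>R x \<le> p" using s by simp
  moreover have "(1 / s) *\<^sub>R x \<le> 1 *\<^sub>R x" using s x0 by (intro scaleR_right_mono) auto
  then have "(1 / s) *\<^sub>R x \<le> x" by simp
  then have "(1 / s) *\<^sub>R x \<le> g" unfolding x_def by (simp only: le_inf_iff)
  ultimately have "(1 / s) *\<^sub>R x \<le> 0" unfolding pg[symmetric] by (rule inf_greatest)
  then have "s *\<^sub>R (1 / s) *\<^sub>R x \<le> s *\<^sub>R 0" using s by (intro scaleR_left_mono) auto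
  then have "x \<le> 0" using s by simp
  then show ?thesis using x0 unfolding x_def by (rule antisym)
qed

text \<open>For a real number \<open>\<pi>\<close> this is \<open>\<pi> \<le> 1 / t + t \<pi>\<^sup>2\<close>, a weak form of \<open>0 \<le> (1 - t \<pi>)\<^sup>2\<close>. The proof
  splits \<open>d = t \<pi> w - w\<close> into its positive part \<open>g\<close> and its negative part \<open>h\<close>, which corresponds to
  the regions \<open>t \<pi> \<ge> 1\<close> and \<open>t \<pi> \<le> 1\<close>: since \<open>\<pi> h\<close> is disjoint from \<open>g\<close> and \<open>h \<le> w\<close>, one gets
  \<open>t \<pi> h \<le> w\<close>, and applying \<open>\<pi>\<close> to \<open>d = g - h\<close> gives the claim.\<close>

lemma positive_orthomorphism_quadratic_bound:
  fixes \<pi> :: "'a::riesz_space \<Rightarrow> 'a"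
  assumes \<pi>: "positive_orthomorphism \<pi>" and w: "0 \<le> w" and t: "t > 0"
  shows "\<pi> w \<le> (1 / t) *\<^sub>R w + t *\<^sub>R \<pi> (\<pi> w)"
proof -
  have lin: "linear \<pi>" and pos: "\<And>x. 0 \<le> x \<Longrightarrow> 0 \<le> \<pi> x"
    and disj: "\<And>x y. inf x y = 0 \<Longrightarrow> inf (\<pi> x) y = 0"
    using \<pi> by (auto simp: positive_orthomorphism_def positive_operator_def)
  have mono: "\<pi> x \<le> \<pi> y" if "x \<le> y" for x y
    using \<pi> that by (simp add: positive_orthomorphism_def positive_operator_mono)
  define d where "d = t *\<^sub>R \<pi> w - w"
  define g h where "g = sup d 0" and "h = sup (- d) 0"
  have d: "d = g - h" unfolding g_def h_def
    using prts[of d] by (simp only: pprt_def nprt_def inf_eq_neg_sup[of d 0] minus_zero diff_conv_add_uminus)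
  have g0: "0 \<le> g" and h0: "0 \<le> h" by (simp_all add: g_def h_def)
  have "inf h g = inf (- d + g) (0 + g)" using d by simp
  also have "\<dots> = inf (- d) 0 + g" by (simp only: add_inf_distrib_right)
  also have "\<dots> = 0" by (simp only: g_def sup_eq_neg_inf[of d 0] minus_zero add.right_inverse)
  finally have gh: "inf (t *\<^sub>R \<pi> h) g = 0"
    using disj inf_scaleR_eq_0 pos[OF h0] g0 t by blast
  have "- d \<le> w" using pos[OF w] t by (simp add: d_def scaleR_nonneg_nonneg)
  then have "h \<le> w" unfolding h_def using w by (rule sup_least)
  then have "t *\<^sub>R \<pi> h \<le> t *\<^sub>R \<pi> w"
    using t mono by (intro scaleR_left_mono) auto
  also have "\<dots> = w + d" by (simp add: d_def)
  also have "\<dots> \<le> w + g" using d h0 by simp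
  finally have "t *\<^sub>R \<pi> h \<le> w + g" .
  moreover have "t *\<^sub>R \<pi> h \<le> w + t *\<^sub>R \<pi> h" using w by simp
  ultimately have "t *\<^sub>R \<pi> h \<le> inf (w + t *\<^sub>R \<pi> h) (w + g)" by (rule inf_greatest[rotated])
  then have "t *\<^sub>R \<pi> h \<le> w" by (simp only: gh add_0_right flip: add_inf_distrib_left)
  moreover have "0 \<le> t *\<^sub>R \<pi> g" using t pos[OF g0] by (simp add: scaleR_nonneg_nonneg)
  ultimately have "t *\<^sub>R \<pi> h + 0 \<le> w + t *\<^sub>R \<pi> g" by (rule add_mono)
  moreover have "\<pi> d = t *\<^sub>R \<pi> (\<pi> w) - \<pi> w"
    unfolding d_def using lin by (simp add: linear_diff linear_scale)
  then have "\<pi> g = t *\<^sub>R \<pi> (\<pi> w) - \<pi> w + \<pi> h"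
    unfolding d using lin by (simp add: linear_diff algebra_simps)
  ultimately have "t *\<^sub>R \<pi> w \<le> w + t *\<^sub>R t *\<^sub>R \<pi> (\<pi> w)"
    by (simp add: algebra_simps)
  then have "(1 / t) *\<^sub>R t *\<^sub>R \<pi> w \<le> (1 / t) *\<^sub>R (w + t *\<^sub>R t *\<^sub>R \<pi> (\<pi> w))"
    using t by (intro scaleR_left_mono) auto
  then show ?thesis using t by (simp add: scaleR_add_right)
qed

text \<open>Let \<open>z\<close> be an upper bound of \<open>\<pi> ` X\<close>. For \<open>x \<in> X\<close> the quadratic bound gives
  \<open>\<pi> c - z \<le> \<pi> (c - x) \<le> (c - x) / t + t \<pi>\<^sup>2 (c - l)\<close>, where the last term does not depend on \<open>x\<close>. Passing
  to the infimum over \<open>x\<close>, for which \<open>c - x\<close> has infimum \<open>0\<close>, leaves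
  \<open>\<pi> c - z \<le> t \<pi>\<^sup>2 (c - l)\<close> for all \<open>t > 0\<close>. The lower bound \<open>l\<close> serves to make the quadratic term
  uniform.\<close>

lemma positive_orthomorphism_lub:
  fixes \<pi> :: "'a::archimedean_riesz_space \<Rightarrow> 'a"
  assumes \<pi>: "positive_orthomorphism \<pi>" and c: "is_lub X c"
    and l: "\<And>x. x \<in> X \<Longrightarrow> l \<le> x"
  shows "is_lub (\<pi> ` X) (\<pi> c)"
proof -
  have lin: "linear \<pi>" and mono: "\<And>x y. x \<le> y \<Longrightarrow> \<pi> x \<le> \<pi> y"
    using \<pi> positive_operator_mono by (auto simp: positive_orthomorphism_def positive_operator_def)
  have le_c: "x \<le> c" if "x \<in> X" for x using c that by (auto simp: is_lub_def)
  have "\<pi> c \<le> z" if z: "\<forall>x\<in>\<pi> ` X. x \<le> z" for z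
  proof (rule archimedean_leI)
    fix t :: real assume t: "t > 0"
    define v where "v = \<pi> c - z - t *\<^sub>R \<pi> (\<pi> (c - l))"
    have "x \<le> c - t *\<^sub>R v" if x: "x \<in> X" for x
    proof -
      have "\<pi> c - z \<le> \<pi> (c - x)" using x z lin by (simp add: linear_diff)
      also have "\<dots> \<le> (1 / t) *\<^sub>R (c - x) + t *\<^sub>R \<pi> (\<pi> (c - x))"
        using le_c[OF x] t by (intro positive_orthomorphism_quadratic_bound \<pi>) auto
      also have "\<dots> \<le> (1 / t) *\<^sub>R (c - x) + t *\<^sub>R \<pi> (\<pi> (c - l))"
        using l[OF x] t by (intro add_left_mono scaleR_left_mono mono) auto
      finally have "v \<le> (1 / t) *\<^sub>R (c - x)" by (simp add: v_def algebra_simps)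
      then have "t *\<^sub>R v \<le> t *\<^sub>R (1 / t) *\<^sub>R (c - x)" using t by (intro scaleR_left_mono) auto
      then show ?thesis using t by (simp add: algebra_simps)
    qed
    then have "c \<le> c - t *\<^sub>R v" using c by (auto simp: is_lub_def)
    then have "t *\<^sub>R v \<le> 0" by simp
    then have "(1 / t) *\<^sub>R t *\<^sub>R v \<le> (1 / t) *\<^sub>R 0" using t by (intro scaleR_left_mono) auto
    then have "v \<le> 0" using t by simp
    then show "\<pi> c \<le> z + t *\<^sub>R \<pi> (\<pi> (c - l))" by (simp add: v_def algebra_simps)
  qed
  moreover have "\<pi> x \<le> z" if "\<pi> c \<le> z" "x \<in> X" for x z
    using mono[OF le_c[OF that(2)]] that(1) by (rule order_trans)
  ultimately show ?thesis unfolding is_lub_def by blast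
qed

lemma subunits_lub:
  fixes Y :: "'a::archimedean_semiprime_f_algebra set"
  assumes y: "is_lub Y y" and sub: "Y \<subseteq> subunits" and ne: "Y \<noteq> {}"
  shows "y \<in> subunits"
proof -
  have Y0: "0 \<le> s" if "s \<in> Y" for s using that sub by (auto simp: subunits_def)
  obtain s where "s \<in> Y" using ne by blast
  then have "0 \<le> s" "s \<le> y" using Y0 y by (auto simp: is_lub_def)
  then have "0 \<le> y" by (rule order_trans)
  moreover have "y * b \<le> b" if b: "0 \<le> b" for b
  proof -
    have "is_lub ((\<lambda>s. s * b) ` Y) (y * b)"
      using positive_orthomorphism_lub[OF positive_orthomorphism_mult_right[OF b] y] Y0 by blast
    then show ?thesis using sub b by (auto simp: is_lub_def subunits_def)
  qed
  ultimately show ?thesis by (simp add: subunits_def)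
qed

section \<open>Order density\<close>

lemma riesz_embedding_le_iff:
  assumes "riesz_embedding h"
  shows "h x \<le> h y \<longleftrightarrow> x \<le> y"
  using assms by (metis injD le_iff_sup riesz_embedding_def)

text \<open>Let \<open>z\<close> be an upper bound with \<open>\<not> d \<le> z\<close>, and put \<open>i = inf d z\<close>. Order density yields
  \<open>0 < k a \<le> d - i\<close>. Adding \<open>k a\<close> to an element \<open>k b' \<le> d\<close> gives again an element below \<open>d\<close>, as
  \<open>k b' \<le> i\<close>. Iterating this contradicts the Archimedean property; it is applied in \<open>'a\<close>, with bounds
  that exist because \<open>k\<close> is majorizing.\<close>

lemma dedekind_completion_lub:
  fixes k :: "'a::archimedean_riesz_space \<Rightarrow> 'd::dedekind_complete_riesz_space"
  assumes k: "dedekind_completion k"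
  shows "is_lub {k a | a. k a \<le> d} d"
  unfolding is_lub_def
proof (intro allI iffI ballI)
  fix z assume z: "\<forall>x\<in>{k a | a. k a \<le> d}. x \<le> z"
  have emb: "riesz_embedding k" using k by (simp add: dedekind_completion_def)
  then have lin: "linear k" by (simp add: riesz_embedding_def)
  show "d \<le> z"
  proof (rule ccontr)
    assume "\<not> d \<le> z"
    define i where "i = inf d z"
    have "i < d" unfolding i_def using \<open>\<not> d \<le> z\<close> by (metis inf.cobounded1 inf.cobounded2 order_le_less)
    then have "0 < d - i" by (simp only: diff_gt_0_iff_gt)
    then obtain a where a: "0 < k a" "k a \<le> d - i"
      using k unfolding dedekind_completion_def by blast
    have "k 0 \<le> k a" using a(1) lin by (simp add: linear_0)
    then have a0: "0 \<le> a" by (simp only: riesz_embedding_le_iff[OF emb])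
    obtain m where m: "d \<le> k m" using k unfolding dedekind_completion_def by blast
    obtain b where b: "- d \<le> k b" using k unfolding dedekind_completion_def by blast
    have step: "k (b' + a) \<le> d" if "k b' \<le> d" for b'
    proof -
      have "k b' \<le> i" unfolding i_def using that z by (intro inf_greatest) auto
      then have "k b' + k a \<le> i + (d - i)" using a(2) by (rule add_mono)
      then show ?thesis using lin by (simp add: linear_add)
    qed
    \<comment> \<open>\<open>k (- b)\<close> is an element of the range of \<open>k\<close> below \<open>d\<close>, from which the iteration can start.\<close>
    have "k (- b + real n *\<^sub>R a) \<le> d" for n
    proof (induction n)
      case 0
      have "- k b \<le> d" using b by (simp only: minus_le_iff)
      then show ?case using lin by (simp add: linear_neg)
    next
      case (Suc n)
      have "- b + real (Suc n) *\<^sub>R a = (- b + real n *\<^sub>R a) + a" by (simp add: scaleR_left_distrib)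
      then show ?case using step[OF Suc] by (simp only:)
    qed
    then have "k (- b + real n *\<^sub>R a) \<le> k m" for n using m by (rule order_trans)
    then have "- b + real n *\<^sub>R a \<le> m" for n by (simp only: riesz_embedding_le_iff[OF emb])
    then have "real n *\<^sub>R a \<le> m + b" for n by (simp only: uminus_add_conv_diff diff_le_eq)
    then have "a = 0" by (rule archimedean[OF a0])
    then show False using a(1) lin by (simp add: linear_0)
  qed
next
  fix z x assume "d \<le> z" "x \<in> {k a | a. k a \<le> d}"
  then have "x \<le> d" by blast
  then show "x \<le> z" using \<open>d \<le> z\<close> by (rule order_trans)
qed

section \<open>Extending a positive operator by squeezing\<close>

text \<open>The least value at \<open>x\<close> that monotonicity permits to an extension of \<open>T\<close> along \<open>k\<close>. For linear \<open>k\<close> and \<open>T\<close>, having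
  \<open>- y\<close> as the lower value at \<open>- x\<close> means that \<open>y\<close> is the infimum of all \<open>T a\<close> with \<open>x \<le> k a\<close>. Expressing
  the upper half of \<open>squeezed_value\<close> in this way lets every fact about infima be read off from one about
  suprema.\<close>

definition lower_value :: "('a::riesz_space \<Rightarrow> 'd::riesz_space) \<Rightarrow> ('a \<Rightarrow> 'b::riesz_space) \<Rightarrow> 'd \<Rightarrow> 'b \<Rightarrow> bool" where
  "lower_value k T x y \<longleftrightarrow> is_lub {T a | a. k a \<le> x} y"

definition squeezed_value :: "('a::riesz_space \<Rightarrow> 'd::riesz_space) \<Rightarrow> ('a \<Rightarrow> 'b::riesz_space) \<Rightarrow> 'd \<Rightarrow> 'b \<Rightarrow> bool" where
  "squeezed_value k T x y \<longleftrightarrow> lower_value k T x y \<and> lower_value k T (- x) (- y)"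

lemma lower_value_le_iff:
  "lower_value k T x y \<Longrightarrow> y \<le> z \<longleftrightarrow> (\<forall>a. k a \<le> x \<longrightarrow> T a \<le> z)"
  by (auto simp: lower_value_def is_lub_def)

lemma lower_value_ge: "lower_value k T x y \<Longrightarrow> k a \<le> x \<Longrightarrow> T a \<le> y"
  by (auto simp: lower_value_def is_lub_def)

lemma lower_value_mono:
  "lower_value k T x y \<Longrightarrow> lower_value k T x' y' \<Longrightarrow> x \<le> x' \<Longrightarrow> y \<le> y'"
  by (subst lower_value_le_iff) (blast intro: lower_value_ge dest: order_trans)+

lemma squeezed_value_unique:
  "squeezed_value k T x y \<Longrightarrow> squeezed_value k T x y' \<Longrightarrow> y = y'"
  unfolding squeezed_value_def by (meson antisym lower_value_mono order_refl)

lemma lower_value_embed: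
  assumes "riesz_embedding k" "positive_operator T"
  shows "lower_value k T (k a) (T a)"
  unfolding lower_value_def is_lub_def
  using riesz_embedding_le_iff[OF assms(1)] positive_operator_mono[OF assms(2)]
  by (smt (verit, best) mem_Collect_eq order_refl order_trans)

lemma squeezed_value_embed:
  assumes "riesz_embedding k" "positive_operator T"
  shows "squeezed_value k T (k a) (T a)"
  using lower_value_embed[OF assms, of a] lower_value_embed[OF assms, of "- a"] assms
  by (simp add: squeezed_value_def riesz_embedding_def positive_operator_def linear_neg)

lemma lower_value_superadditive:
  assumes "linear k" "linear T" and x: "lower_value k T x y" and x': "lower_value k T x' y'"
    and "lower_value k T (x + x') y''"
  shows "y + y' \<le> y''"
proof -
  have "T a + T a' \<le> y''" if "k a \<le> x" "k a' \<le> x'" for a a'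
    using lower_value_ge[OF assms(5), of "a + a'"] add_mono[OF that] assms(1,2)
    by (simp add: linear_add)
  then have "T a' \<le> y'' - y" if "k a' \<le> x'" for a'
    using that lower_value_le_iff[OF x, of "y'' - T a'"] by (simp add: algebra_simps)
  then show ?thesis using lower_value_le_iff[OF x', of "y'' - y"] by (simp add: algebra_simps)
qed

text \<open>Superadditivity at \<open>x\<close>, \<open>x'\<close> and at \<open>- x\<close>, \<open>- x'\<close> gives the two inequalities; this is where
  linearity of the extension needs the value to be squeezed from both sides.\<close>

lemma squeezed_value_add:
  assumes "linear k" "linear T" "squeezed_value k T x y" "squeezed_value k T x' y'"
    and "squeezed_value k T (x + x') y''"
  shows "y'' = y + y'"
proof (rule antisym)
  have "- y + - y' \<le> - y''"
    using assms lower_value_superadditive[OF assms(1,2), of "- x" "- y" "- x'" "- y'" "- y''"]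
    by (simp add: squeezed_value_def)
  then show "y'' \<le> y + y'" by (metis minus_add_distrib neg_le_iff_le add.commute)
  show "y + y' \<le> y''"
    using assms lower_value_superadditive[OF assms(1,2)] by (auto simp: squeezed_value_def)
qed

lemma lower_value_scaleR_pos:
  fixes k :: "'a::riesz_space \<Rightarrow> 'd::riesz_space" and T :: "'a \<Rightarrow> 'b::riesz_space"
  assumes "linear k" "linear T" "lower_value k T x y" "r > 0"
  shows "lower_value k T (r *\<^sub>R x) (r *\<^sub>R y)"
proof -
  have "r *\<^sub>R y \<le> z \<longleftrightarrow> (\<forall>a. k a \<le> r *\<^sub>R x \<longrightarrow> T a \<le> z)" for z
  proof -
    have eq: "u \<le> r *\<^sub>R v \<longleftrightarrow> (1 / r) *\<^sub>R u \<le> v" for u v :: 'd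
      using assms(4) pos_divideR_le_eq[of r u v] by (simp add: divide_inverse)
    have "r *\<^sub>R y \<le> z \<longleftrightarrow> y \<le> (1 / r) *\<^sub>R z"
      using assms(4) pos_le_divideR_eq[of r y z] by (simp add: divide_inverse)
    also have "\<dots> \<longleftrightarrow> (\<forall>a. k a \<le> x \<longrightarrow> T a \<le> (1 / r) *\<^sub>R z)" by (rule lower_value_le_iff[OF assms(3)])
    also have "\<dots> \<longleftrightarrow> (\<forall>a. k a \<le> r *\<^sub>R x \<longrightarrow> T a \<le> z)"
    proof safe
      fix a assume "\<forall>a. k a \<le> x \<longrightarrow> T a \<le> (1 / r) *\<^sub>R z" "k a \<le> r *\<^sub>R x"
      then have "T ((1 / r) *\<^sub>R a) \<le> (1 / r) *\<^sub>R z"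
        using assms(1) eq by (simp add: linear_scale)
      then have "r *\<^sub>R T ((1 / r) *\<^sub>R a) \<le> r *\<^sub>R (1 / r) *\<^sub>R z"
        using assms(4) by (intro scaleR_left_mono) auto
      then show "T a \<le> z" using assms(2,4) by (simp add: linear_scale)
    next
      fix a assume H: "\<forall>a. k a \<le> r *\<^sub>R x \<longrightarrow> T a \<le> z" "k a \<le> x"
      then have "r *\<^sub>R T a \<le> z"
        using assms scaleR_left_mono[OF H(2), of r] by (metis less_imp_le linear_scale)
      then have "(1 / r) *\<^sub>R r *\<^sub>R T a \<le> (1 / r) *\<^sub>R z"
        using assms(4) by (intro scaleR_left_mono) auto
      then show "T a \<le> (1 / r) *\<^sub>R z" using assms(4) by simp
    qed
    finally show ?thesis .
  qed
  then show ?thesis by (auto simp: lower_value_def is_lub_def)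
qed

lemma squeezed_value_scaleR:
  assumes "riesz_embedding k" "positive_operator T" and xy: "squeezed_value k T x y"
  shows "squeezed_value k T (r *\<^sub>R x) (r *\<^sub>R y)"
proof -
  have lin: "linear k" "linear T" using assms by (auto simp: riesz_embedding_def positive_operator_def)
  consider "r = 0" | "r > 0" | "- r > 0" by linarith
  then show ?thesis
  proof cases
    case 1
    then show ?thesis using squeezed_value_embed[OF assms(1,2), of 0] lin by (simp add: linear_0)
  next
    case 2
    then show ?thesis
      using lower_value_scaleR_pos[OF lin _ 2, of x y] lower_value_scaleR_pos[OF lin _ 2, of "- x" "- y"] xy
      by (simp add: squeezed_value_def)
  next
    case 3
    then show ?thesis
      using lower_value_scaleR_pos[OF lin _ 3, of x y] lower_value_scaleR_pos[OF lin _ 3, of "- x" "- y"] xy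
      by (simp add: squeezed_value_def)
  qed
qed

lemma two_sided_bound_uminus:
  fixes a b c :: "'a::riesz_space"
  assumes "a \<le> b + c \<and> b \<le> a + c"
  shows "- a \<le> - b + c \<and> - b \<le> - a + c"
  using assms by (simp add: algebra_simps)

text \<open>If \<open>f n\<close> and \<open>x\<close> differ by at most \<open>\<epsilon> k v\<close>, an element \<open>a\<close> with \<open>k a\<close> below one of them can be moved
  below the other by subtracting \<open>\<epsilon> v\<close>. This changes \<open>T a\<close> by \<open>\<epsilon> T v\<close> only, so all errors vanish by the
  Archimedean property.\<close>

lemma lower_value_limit:
  fixes T :: "'a::riesz_space \<Rightarrow> 'b::archimedean_riesz_space"
    and f :: "nat \<Rightarrow> 'd::riesz_space"
  assumes lin: "linear k" "linear T"
    and val: "\<And>n. lower_value k T (f n) (g n)"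
    and f: "\<And>\<epsilon>. \<epsilon> > 0 \<Longrightarrow> \<exists>N. \<forall>n\<ge>N. f n \<le> x + \<epsilon> *\<^sub>R k v \<and> x \<le> f n + \<epsilon> *\<^sub>R k v"
    and g: "\<And>\<epsilon>. \<epsilon> > 0 \<Longrightarrow> \<exists>N. \<forall>n\<ge>N. g n \<le> y + \<epsilon> *\<^sub>R w \<and> y \<le> g n + \<epsilon> *\<^sub>R w"
  shows "lower_value k T x y"
proof -
  have close: "\<exists>n. f n \<le> x + \<epsilon> *\<^sub>R k v \<and> x \<le> f n + \<epsilon> *\<^sub>R k v
    \<and> g n \<le> y + \<epsilon> *\<^sub>R w \<and> y \<le> g n + \<epsilon> *\<^sub>R w" if "\<epsilon> > 0" for \<epsilon>
  proof -
    obtain M where "\<forall>n\<ge>M. f n \<le> x + \<epsilon> *\<^sub>R k v \<and> x \<le> f n + \<epsilon> *\<^sub>R k v"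
      using f[OF \<open>\<epsilon> > 0\<close>] ..
    moreover obtain N where "\<forall>n\<ge>N. g n \<le> y + \<epsilon> *\<^sub>R w \<and> y \<le> g n + \<epsilon> *\<^sub>R w"
      using g[OF \<open>\<epsilon> > 0\<close>] ..
    moreover have "M \<le> max M N" "N \<le> max M N" by simp_all
    ultimately show ?thesis by blast
  qed
  have shift: "k (a - \<epsilon> *\<^sub>R v) = k a - \<epsilon> *\<^sub>R k v" "T (a - \<epsilon> *\<^sub>R v) = T a - \<epsilon> *\<^sub>R T v" for a \<epsilon>
    using lin by (simp_all add: linear_diff linear_scale)
  have upper: "T a \<le> y" if a: "k a \<le> x" for a
  proof (rule archimedean_leI)
    fix \<epsilon> :: real assume "\<epsilon> > 0"
    from close[OF this] obtain n where n: "x \<le> f n + \<epsilon> *\<^sub>R k v" "g n \<le> y + \<epsilon> *\<^sub>R w" by blast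
    have "k (a - \<epsilon> *\<^sub>R v) \<le> f n" using order_trans[OF a n(1)] by (simp add: shift algebra_simps)
    from lower_value_ge[OF val this] have "T a \<le> g n + \<epsilon> *\<^sub>R T v" by (simp add: shift algebra_simps)
    also have "\<dots> \<le> y + \<epsilon> *\<^sub>R w + \<epsilon> *\<^sub>R T v" using n(2) by simp
    finally show "T a \<le> y + \<epsilon> *\<^sub>R (w + T v)" by (simp add: algebra_simps)
  qed
  have least: "y \<le> z" if z: "\<And>a. k a \<le> x \<Longrightarrow> T a \<le> z" for z
  proof (rule archimedean_leI)
    fix \<epsilon> :: real assume "\<epsilon> > 0"
    from close[OF this] obtain n where n: "f n \<le> x + \<epsilon> *\<^sub>R k v" "y \<le> g n + \<epsilon> *\<^sub>R w" by blast
    have "T a \<le> z + \<epsilon> *\<^sub>R T v" if "k a \<le> f n" for a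
      using z[of "a - \<epsilon> *\<^sub>R v"] order_trans[OF that n(1)] by (simp add: shift algebra_simps)
    then have "g n \<le> z + \<epsilon> *\<^sub>R T v" using lower_value_le_iff[OF val] by blast
    then have "g n + \<epsilon> *\<^sub>R w \<le> z + \<epsilon> *\<^sub>R T v + \<epsilon> *\<^sub>R w" by simp
    from order_trans[OF n(2) this] show "y \<le> z + \<epsilon> *\<^sub>R (T v + w)" by (simp add: algebra_simps)
  qed
  have "T a \<le> z" if "y \<le> z" "k a \<le> x" for a z using upper[OF that(2)] that(1) by (rule order_trans)
  with least show ?thesis unfolding lower_value_def is_lub_def by blast
qed

text \<open>Because \<open>k\<close> is majorizing, the regulator of a convergent sequence may be taken of the form \<open>k v\<close>. The
  values at the members of the sequence are then relatively uniformly Cauchy with regulator \<open>T v\<close>, and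
  their limit, which exists by completeness, is the value at the limit.\<close>

lemma ru_closed_squeezed:
  fixes T :: "'a::riesz_space \<Rightarrow> 'b::{archimedean_riesz_space, ru_complete_riesz_space}"
    and k :: "'a \<Rightarrow> 'd::riesz_space"
  assumes k: "riesz_embedding k" and maj: "\<And>d. \<exists>a. d \<le> k a" and T: "positive_operator T"
  shows "ru_closed {x. \<exists>y. squeezed_value k T x y}"
  unfolding ru_closed_def
proof (intro allI impI, elim conjE)
  fix f :: "nat \<Rightarrow> 'd" and x
  assume "\<forall>n. f n \<in> {x. \<exists>y. squeezed_value k T x y}" and lim: "ru_tendsto f x"
  then have "\<forall>n. \<exists>y. squeezed_value k T (f n) y" by simp
  then obtain g where g: "\<And>n. squeezed_value k T (f n) (g n)" by metis
  have lin: "linear k" "linear T" using k T by (auto simp: riesz_embedding_def positive_operator_def)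
  obtain u where u: "0 \<le> u"
    "\<And>\<epsilon>. \<epsilon> > 0 \<Longrightarrow> \<exists>N. \<forall>n\<ge>N. f n \<le> x + \<epsilon> *\<^sub>R u \<and> x \<le> f n + \<epsilon> *\<^sub>R u"
    using ru_tendsto_bounds[OF lim] by blast
  obtain v where v: "u \<le> k v" using maj by blast
  have v0: "0 \<le> v"
    using order_trans[OF u(1) v] riesz_embedding_le_iff[OF k, of 0 v] lin by (simp add: linear_0)
  have f: "\<exists>N. \<forall>n\<ge>N. f n \<le> x + \<epsilon> *\<^sub>R k v \<and> x \<le> f n + \<epsilon> *\<^sub>R k v" if "\<epsilon> > 0" for \<epsilon>
  proof -
    have "\<epsilon> *\<^sub>R u \<le> \<epsilon> *\<^sub>R k v" using v that by (intro scaleR_left_mono) auto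
    then have "x + \<epsilon> *\<^sub>R u \<le> x + \<epsilon> *\<^sub>R k v" "\<And>n. f n + \<epsilon> *\<^sub>R u \<le> f n + \<epsilon> *\<^sub>R k v" by simp_all
    moreover obtain N where "\<And>n. n \<ge> N \<Longrightarrow> f n \<le> x + \<epsilon> *\<^sub>R u \<and> x \<le> f n + \<epsilon> *\<^sub>R u"
      using u(2)[OF \<open>\<epsilon> > 0\<close>] by blast
    ultimately show ?thesis by (intro exI[of _ N]) (blast intro: order_trans)
  qed
  have step: "g m \<le> g n + \<epsilon> *\<^sub>R T v" if "f m \<le> f n + \<epsilon> *\<^sub>R k v" for m n \<epsilon>
  proof -
    have "T a \<le> g n + \<epsilon> *\<^sub>R T v" if "k a \<le> f m" for a
    proof -
      have "k (a - \<epsilon> *\<^sub>R v) \<le> f n"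
        using order_trans[OF that \<open>f m \<le> f n + \<epsilon> *\<^sub>R k v\<close>] lin
        by (simp add: linear_diff linear_scale algebra_simps)
      then have "T (a - \<epsilon> *\<^sub>R v) \<le> g n" using g lower_value_ge unfolding squeezed_value_def by blast
      then show ?thesis using lin by (simp add: linear_diff linear_scale algebra_simps)
    qed
    then show ?thesis using g lower_value_le_iff unfolding squeezed_value_def by blast
  qed
  have "ru_Cauchy g"
    unfolding ru_Cauchy_def
  proof (intro exI[of _ "T v"] conjI allI impI)
    show "0 \<le> T v" using T v0 by (simp add: positive_operator_def)
    fix \<epsilon> :: real assume "\<epsilon> > 0"
    then obtain N where N: "\<And>n. n \<ge> N \<Longrightarrow> f n \<le> x + (\<epsilon> / 2) *\<^sub>R k v \<and> x \<le> f n + (\<epsilon> / 2) *\<^sub>R k v"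
      using f[of "\<epsilon> / 2"] by auto
    have half: "(\<epsilon> / 2) *\<^sub>R k v + (\<epsilon> / 2) *\<^sub>R k v = \<epsilon> *\<^sub>R k v" by (simp flip: scaleR_left_distrib)
    have "f m \<le> f n + \<epsilon> *\<^sub>R k v" if "m \<ge> N" "n \<ge> N" for m n
    proof -
      have "f m \<le> x + (\<epsilon> / 2) *\<^sub>R k v" using N that by blast
      also have "\<dots> \<le> f n + (\<epsilon> / 2) *\<^sub>R k v + (\<epsilon> / 2) *\<^sub>R k v" using N that by simp
      finally show ?thesis by (simp add: half add.assoc)
    qed
    then have le: "g m - g n \<le> \<epsilon> *\<^sub>R T v" if "m \<ge> N" "n \<ge> N" for m n
      using step that by (simp add: algebra_simps)
    have "\<bar>g m - g n\<bar> \<le> \<epsilon> *\<^sub>R T v" if "m \<ge> N" "n \<ge> N" for m n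
      using le[of m n] le[of n m] that by (intro abs_leI) auto
    then show "\<exists>N. \<forall>m\<ge>N. \<forall>n\<ge>N. \<bar>g m - g n\<bar> \<le> \<epsilon> *\<^sub>R T v" by blast
  qed
  then obtain y where "ru_tendsto g y" using ru_complete by blast
  then obtain w where w: "\<And>\<epsilon>. \<epsilon> > 0 \<Longrightarrow> \<exists>N. \<forall>n\<ge>N. g n \<le> y + \<epsilon> *\<^sub>R w \<and> y \<le> g n + \<epsilon> *\<^sub>R w"
    using ru_tendsto_bounds by blast
  have "lower_value k T x y"
  proof (rule lower_value_limit[OF lin _ f w])
    show "lower_value k T (f n) (g n)" for n using g by (simp add: squeezed_value_def)
  qed
  moreover have "lower_value k T (- x) (- y)"
  proof (rule lower_value_limit[OF lin, where f = "\<lambda>n. - f n" and g = "\<lambda>n. - g n"])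
    show "lower_value k T (- f n) (- g n)" for n using g by (simp add: squeezed_value_def)
    show "\<exists>N. \<forall>n\<ge>N. - f n \<le> - x + \<epsilon> *\<^sub>R k v \<and> - x \<le> - f n + \<epsilon> *\<^sub>R k v" if "\<epsilon> > 0" for \<epsilon>
      using f[OF that] two_sided_bound_uminus by blast
    show "\<exists>N. \<forall>n\<ge>N. - g n \<le> - y + \<epsilon> *\<^sub>R w \<and> - y \<le> - g n + \<epsilon> *\<^sub>R w" if "\<epsilon> > 0" for \<epsilon>
      using w[OF that] two_sided_bound_uminus by blast
  qed
  ultimately show "x \<in> {x. \<exists>y. squeezed_value k T x y}" by (auto simp: squeezed_value_def)
qed

section \<open>Contractive operators on the completion\<close>

lemma ru_completion_embedding:
  assumes "ru_completion j e"
  shows "riesz_embedding j"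
proof -
  have e: "linear e" "inj e"
      "\<And>x y. e (sup x y) = sup (e x) (e y)" "\<And>x y. e (inf x y) = inf (e x) (e y)"
    and k: "linear (e \<circ> j)" "inj (e \<circ> j)"
      "\<And>x y. e (j (sup x y)) = sup (e (j x)) (e (j y))" "\<And>x y. e (j (inf x y)) = inf (e (j x)) (e (j y))"
    using assms by (auto simp: ru_completion_def dedekind_completion_def riesz_embedding_def)
  have "linear j"
  proof (rule linearI)
    show "j (x + y) = j x + j y" for x y
      using linear_add[OF k(1), of x y] linear_add[OF e(1), of "j x" "j y"]
      by (intro injD[OF e(2)]) simp
    show "j (r *\<^sub>R x) = r *\<^sub>R j x" for r x
      using linear_scale[OF k(1), of r x] linear_scale[OF e(1), of r "j x"]
      by (intro injD[OF e(2)]) simp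
  qed
  moreover have "inj j" using k(2) by (rule inj_on_imageI2)
  moreover have "j (sup x y) = sup (j x) (j y)" for x y
    by (rule injD[OF e(2)]) (simp only: e k)
  moreover have "j (inf x y) = inf (j x) (j y)" for x y
    by (rule injD[OF e(2)]) (simp only: e k)
  ultimately show ?thesis by (simp add: riesz_embedding_def)
qed

lemma ru_completion_embed_le:
  assumes "ru_completion j e"
  shows "(e \<circ> j) a \<le> e x \<longleftrightarrow> j a \<le> x"
  using assms riesz_embedding_le_iff[of e "j a" x] by (simp add: ru_completion_def)

text \<open>Monotonicity traps \<open>S x\<close> between the supremum and the infimum that determine \<open>y\<close>. This gives
  uniqueness of the positive extension.\<close>

lemma positive_extension_squeezed:
  assumes je: "ru_completion j e" and S: "positive_operator S" and ext: "\<forall>a. S (j a) = T a"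
    and y: "squeezed_value (e \<circ> j) T (e x) y"
  shows "S x = y"
proof (rule antisym)
  have e: "linear e" using je by (auto simp: ru_completion_def riesz_embedding_def)
  have le: "y' \<le> S x'" if "lower_value (e \<circ> j) T (e x') y'" for x' y'
    using lower_value_le_iff[OF that] ru_completion_embed_le[OF je] positive_operator_mono[OF S] ext
    by metis
  show "y \<le> S x" using y le by (auto simp: squeezed_value_def)
  have "- y \<le> S (- x)" using y e le[of "- x" "- y"] by (simp add: squeezed_value_def linear_neg)
  then show "S x \<le> y" using S by (simp add: positive_operator_def linear_neg)
qed

lemma ex_squeezed_value_on_completion:
  fixes T :: "'a::archimedean_semiprime_f_algebra \<Rightarrow> 'b::{archimedean_riesz_space, ru_complete_riesz_space}"
  assumes je: "ru_completion j e" and T: "positive_operator T"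
  shows "\<exists>y. squeezed_value (e \<circ> j) T (e x) y"
proof -
  have k: "riesz_embedding (e \<circ> j)" "\<And>d. \<exists>a. d \<le> (e \<circ> j) a"
    using je by (auto simp: ru_completion_def dedekind_completion_def)
  have "ru_closed {x. \<exists>y. squeezed_value (e \<circ> j) T x y}"
    by (rule ru_closed_squeezed[OF k T])
  moreover have "range (e \<circ> j) \<subseteq> {x. \<exists>y. squeezed_value (e \<circ> j) T x y}"
    using squeezed_value_embed[OF k(1) T] by blast
  moreover have "e x \<in> ru_closure (range (e \<circ> j))" using je by (auto simp: ru_completion_def)
  ultimately show ?thesis unfolding ru_closure_def by blast
qed

lemma ex1_positive_extension:
  fixes T :: "'a::archimedean_semiprime_f_algebra \<Rightarrow> 'b::{archimedean_riesz_space, ru_complete_riesz_space}"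
  assumes je: "ru_completion j e" and T: "positive_operator T"
  shows "\<exists>!S. positive_operator S \<and> (\<forall>a. S (j a) = T a)"
proof -
  define S where "S x = (SOME y. squeezed_value (e \<circ> j) T (e x) y)" for x
  have S: "squeezed_value (e \<circ> j) T (e x) (S x)" for x
    unfolding S_def by (rule someI_ex[OF ex_squeezed_value_on_completion[OF je T]])
  have k: "riesz_embedding (e \<circ> j)" and e: "riesz_embedding e"
    using je by (auto simp: ru_completion_def dedekind_completion_def)
  have lin: "linear (e \<circ> j)" "linear T" "linear e"
    using k e T by (auto simp: riesz_embedding_def positive_operator_def)
  have "positive_operator S"
    unfolding positive_operator_def
  proof (intro conjI allI impI linearI)
    show "S (x + x') = S x + S x'" for x x'
      using squeezed_value_add[OF lin(1,2) S S, of x x'] S[of "x + x'"] lin(3) by (simp add: linear_add)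
    show "S (r *\<^sub>R x) = r *\<^sub>R S x" for r x
      using squeezed_value_unique[OF S[of "r *\<^sub>R x"]] squeezed_value_scaleR[OF k T S, of r x] lin(3)
      by (simp add: linear_scale)
    fix x :: 'c assume "0 \<le> x"
    then have "(e \<circ> j) 0 \<le> e x" using lin e riesz_embedding_le_iff[of e 0 x] by (metis linear_0)
    then have "T 0 \<le> S x" using S lower_value_ge unfolding squeezed_value_def by blast
    then show "0 \<le> S x" using lin by (simp add: linear_0)
  qed
  moreover have "S (j a) = T a" for a
    using squeezed_value_unique[OF S[of "j a"]] squeezed_value_embed[OF k T, of a] by simp
  moreover have "S' = S" if "positive_operator S' \<and> (\<forall>a. S' (j a) = T a)" for S'
    using positive_extension_squeezed[OF je conjunct1[OF that] conjunct2[OF that] S] by (rule ext)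
  ultimately show ?thesis by (intro ex1I[of _ S]) blast+
qed

text \<open>For \<open>b\<close> in the original algebra, \<open>j a * j b \<le> j b\<close> is inherited from \<open>a * b \<le> b\<close>. A general \<open>c \<ge> 0\<close> is
  the supremum of the positive elements \<open>j b\<close> below it, and multiplication by \<open>j a\<close> preserves this
  supremum.\<close>

lemma ru_completion_subunits:
  assumes je: "ru_completion j e" and a: "a \<in> subunits"
  shows "j a \<in> subunits"
proof -
  have j: "riesz_embedding j" by (rule ru_completion_embedding[OF je])
  then have j0: "0 \<le> j x \<longleftrightarrow> 0 \<le> x" for x
    using riesz_embedding_le_iff[OF j, of 0 x] by (simp add: riesz_embedding_def linear_0)
  have e: "riesz_embedding e" using je by (simp add: ru_completion_def)
  have ja: "0 \<le> j a" using a j0 by (simp add: subunits_def)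
  have "j a * c \<le> c" if c: "0 \<le> c" for c
  proof -
    have "is_lub {(e \<circ> j) b |b. (e \<circ> j) b \<le> e c} (e c)"
      using je unfolding ru_completion_def by (blast intro: dedekind_completion_lub)
    then have "e c \<le> e z \<longleftrightarrow> (\<forall>b. (e \<circ> j) b \<le> e c \<longrightarrow> (e \<circ> j) b \<le> e z)" for z
      unfolding is_lub_def by blast
    then have lub: "c \<le> z \<longleftrightarrow> (\<forall>b. j b \<le> c \<longrightarrow> j b \<le> z)" for z
      by (simp only: ru_completion_embed_le[OF je] riesz_embedding_le_iff[OF e])
    have "is_lub {j b |b. 0 \<le> b \<and> j b \<le> c} c"
      unfolding is_lub_def
    proof (intro allI iffI)
      fix z assume z: "\<forall>x\<in>{j b |b. 0 \<le> b \<and> j b \<le> c}. x \<le> z"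
      have "j b \<le> z" if "j b \<le> c" for b
      proof -
        have "j (sup b 0) \<le> c" using j that c by (simp add: riesz_embedding_def linear_0)
        moreover have "0 \<le> sup b 0" by (rule sup.cobounded2)
        ultimately have "j (sup b 0) \<le> z" using z by blast
        then show ?thesis using j by (simp add: riesz_embedding_def)
      qed
      then show "c \<le> z" using lub by blast
    next
      fix z assume "c \<le> z"
      then have "j b \<le> z" if "j b \<le> c" for b using that lub by blast
      then show "\<forall>x\<in>{j b |b. 0 \<le> b \<and> j b \<le> c}. x \<le> z" by blast
    qed
    then have "is_lub ((*) (j a) ` {j b |b. 0 \<le> b \<and> j b \<le> c}) (j a * c)"
      by (rule positive_orthomorphism_lub[OF positive_orthomorphism_mult_left[OF ja], of _ c 0])
        (auto simp: j0)
    moreover have "j a * j b \<le> c" if "0 \<le> b" "j b \<le> c" for b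
    proof -
      have "a * b \<le> b" using a that by (simp add: subunits_def)
      then have "j (a * b) \<le> j b" using riesz_embedding_le_iff[OF j] by blast
      then show ?thesis using je order_trans[OF _ that(2)] by (simp add: ru_completion_def)
    qed
    ultimately show ?thesis by (auto simp: is_lub_def)
  qed
  with ja show ?thesis by (simp add: subunits_def)
qed

lemma contractive_operator_restrict:
  assumes je: "ru_completion j e" and S: "contractive_operator S"
  shows "contractive_operator (S \<circ> j)"
proof -
  have j: "riesz_embedding j" by (rule ru_completion_embedding[OF je])
  then have "linear j" by (simp add: riesz_embedding_def)
  moreover have "0 \<le> j x" if "0 \<le> x" for x
    using that riesz_embedding_le_iff[OF j, of 0 x] \<open>linear j\<close> by (simp add: linear_0)
  ultimately show ?thesis
    using S ru_completion_subunits[OF je]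
    by (auto simp: contractive_operator_def positive_operator_def intro: linear_compose)
qed

text \<open>For a subunit \<open>x\<close>, the value \<open>S x\<close> is the supremum of the \<open>T a\<close> with \<open>0 \<le> j a \<le> x\<close>. Each such \<open>a\<close> is a
  subunit, hence so is \<open>T a\<close>, and a supremum of subunits is a subunit.\<close>

lemma contractive_operator_extend:
  fixes S :: "'c::archimedean_semiprime_f_algebra \<Rightarrow> 'b::{archimedean_semiprime_f_algebra, ru_complete_riesz_space}"
  assumes je: "ru_completion j e" and T: "contractive_operator T"
    and S: "positive_operator S" and ext: "\<forall>a. S (j a) = T a"
  shows "contractive_operator S"
  unfolding contractive_operator_def
proof (intro conjI ballI S)
  fix x :: 'c assume x: "x \<in> subunits"
  then have x0: "0 \<le> x" by (simp add: subunits_def)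
  have j: "riesz_embedding j" by (rule ru_completion_embedding[OF je])
  then have lin: "linear j" by (simp add: riesz_embedding_def)
  have jpos: "0 \<le> j b \<longleftrightarrow> 0 \<le> b" for b
    using riesz_embedding_le_iff[OF j, of 0 b] lin by (simp add: linear_0)
  have Tpos: "positive_operator T" using T by (simp add: contractive_operator_def)
  obtain y where y: "squeezed_value (e \<circ> j) T (e x) y"
    using ex_squeezed_value_on_completion[OF je Tpos] by blast
  then have low: "lower_value (e \<circ> j) T (e x) (S x)"
    using positive_extension_squeezed[OF je S ext] by (auto simp: squeezed_value_def)
  define Y where "Y = {T a |a. 0 \<le> a \<and> j a \<le> x}"
  have "is_lub Y (S x)"
    unfolding is_lub_def
  proof (intro allI iffI)
    fix z assume z: "\<forall>t\<in>Y. t \<le> z"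
    have "T a \<le> z" if "j a \<le> x" for a
    proof -
      have "j (sup a 0) \<le> x" using j that x0 lin by (simp add: riesz_embedding_def linear_0)
      moreover have "0 \<le> sup a 0" by (rule sup.cobounded2)
      ultimately have "T (sup a 0) \<le> z" using z unfolding Y_def by blast
      moreover have "T a \<le> T (sup a 0)" by (rule positive_operator_mono[OF Tpos]) simp
      ultimately show ?thesis by (rule order_trans[rotated])
    qed
    then show "S x \<le> z" using lower_value_le_iff[OF low] ru_completion_embed_le[OF je] by blast
  next
    fix z assume "S x \<le> z"
    then show "\<forall>t\<in>Y. t \<le> z"
      using lower_value_le_iff[OF low] ru_completion_embed_le[OF je] by (auto simp: Y_def)
  qed
  moreover have "Y \<subseteq> subunits"
  proof (clarsimp simp: Y_def)
    fix a assume a: "0 \<le> a" "j a \<le> x"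
    have "a * b \<le> b" if b: "0 \<le> b" for b
    proof -
      have "j (a * b) = j a * j b" using je by (simp add: ru_completion_def)
      also have "\<dots> \<le> x * j b" using a b jpos by (intro mult_right_mono) auto
      also have "\<dots> \<le> j b" using x b jpos by (simp add: subunits_def)
      finally show ?thesis using riesz_embedding_le_iff[OF j] by blast
    qed
    then have "a \<in> subunits" using a by (simp add: subunits_def)
    then show "T a \<in> subunits" using T by (simp add: contractive_operator_def)
  qed
  moreover have "Y \<noteq> {}" using x0 lin by (auto simp: Y_def linear_0 intro!: exI[of _ 0])
  ultimately show "S x \<in> subunits" by (rule subunits_lub)
qed

section \<open>Transfer of extreme points\<close>

text \<open>The restriction map is not injective on all functions, only on the positive operators. Injectivity on
  a convex set \<open>P\<close> suffices, since the points of a segment with end points in \<open>K\<close> belong to \<open>P\<close>.\<close>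

lemma extreme_point_of_linear_image_inj_on:
  assumes F: "linear F" and P: "convex P" "inj_on F P" and K: "K \<subseteq> P" and x: "x \<in> K"
  shows "F x extreme_point_of F ` K \<longleftrightarrow> x extreme_point_of K"
proof -
  have "F x \<in> open_segment (F a) (F b) \<longleftrightarrow> x \<in> open_segment a b" if ab: "a \<in> K" "b \<in> K" for a b
  proof -
    have "F a = F b \<longleftrightarrow> a = b" using P(2) K ab by (meson inj_on_eq_iff subsetD)
    moreover have "F x = (1 - u) *\<^sub>R F a + u *\<^sub>R F b \<longleftrightarrow> x = (1 - u) *\<^sub>R a + u *\<^sub>R b"
      if "0 < u" "u < 1" for u
    proof -
      have "(1 - u) *\<^sub>R a + u *\<^sub>R b \<in> P"
        using P(1) K ab that by (intro convexD) auto
      then have "F x = F ((1 - u) *\<^sub>R a + u *\<^sub>R b) \<longleftrightarrow> x = (1 - u) *\<^sub>R a + u *\<^sub>R b"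
        using P(2) K x by (meson inj_on_eq_iff subsetD)
      then show ?thesis using F by (simp add: linear_add linear_scale)
    qed
    ultimately show ?thesis by (auto simp: in_segment)
  qed
  with x show ?thesis by (auto simp: extreme_point_of_def)
qed

lemma convex_positive_operators:
  "convex {S :: 'a::riesz_space \<Rightarrow> 'b::riesz_space. positive_operator S}"
  by (rule convexI)
    (auto simp: positive_operator_def plus_fun_def scaleR_fun_def scaleR_nonneg_nonneg
      intro!: linear_compose_add linear_compose_scale_right)

theorem proposition3:
  fixes j :: "'a::archimedean_semiprime_f_algebra \<Rightarrow> 'c::archimedean_semiprime_f_algebra"
    and e :: "'c \<Rightarrow> 'd::dedekind_complete_riesz_space"
    and T :: "'a \<Rightarrow> 'b::{archimedean_semiprime_f_algebra, ru_complete_riesz_space}"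
  assumes "ru_completion j e"
    and "contractive_operator T"
  shows "T extreme_point_of {S :: 'a \<Rightarrow> 'b. contractive_operator S} \<longleftrightarrow>
    ru_extension j T extreme_point_of {S :: 'c \<Rightarrow> 'b. contractive_operator S}"
proof -
  have je: "ru_completion j e" and T: "contractive_operator T" by fact+
  define F :: "('c \<Rightarrow> 'b) \<Rightarrow> 'a \<Rightarrow> 'b" where "F S = S \<circ> j" for S
  define P where "P = {S :: 'c \<Rightarrow> 'b. positive_operator S}"
  define K where "K = {S :: 'c \<Rightarrow> 'b. contractive_operator S}"
  have ext: "\<exists>!S. positive_operator S \<and> (\<forall>a. S (j a) = R a)"
    if "positive_operator R" for R :: "'a \<Rightarrow> 'b"
    by (rule ex1_positive_extension[OF je that])
  have KP: "K \<subseteq> P" by (auto simp: K_def P_def contractive_operator_def)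
  have restrict: "contractive_operator (F S)" if "S \<in> K" for S
    using contractive_operator_restrict[OF je] that by (simp add: K_def F_def)
  have "linear F"
    by (rule linearI) (simp_all add: F_def fun_eq_iff plus_fun_def scaleR_fun_def)
  moreover have "inj_on F P"
  proof (rule inj_onI)
    fix S S' assume S: "S \<in> P" "S' \<in> P" "F S = F S'"
    then have "positive_operator (F S)"
      using riesz_embedding_le_iff[OF ru_completion_embedding[OF je], of 0]
        ru_completion_embedding[OF je]
      by (auto simp: P_def F_def positive_operator_def riesz_embedding_def linear_0 intro: linear_compose)
    from ext[OF this] S show "S = S'" by (auto simp: P_def F_def fun_eq_iff)
  qed
  moreover have image: "F ` K = {R. contractive_operator R}"
  proof (intro equalityI subsetI)
    fix R assume "R \<in> {R :: 'a \<Rightarrow> 'b. contractive_operator R}"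
    then have R: "contractive_operator R" by simp
    then obtain S where S: "positive_operator S" "\<forall>a. S (j a) = R a"
      using ext unfolding contractive_operator_def by blast
    then have "S \<in> K" using contractive_operator_extend[OF je R S] by (simp add: K_def)
    moreover have "R = F S" using S by (simp add: F_def fun_eq_iff)
    ultimately show "R \<in> F ` K" by blast
  qed (use restrict in auto)
  moreover have "ru_extension j T \<in> K" and "F (ru_extension j T) = T"
  proof -
    have "positive_operator T" using T by (simp add: contractive_operator_def)
    from theI'[OF ext[OF this]]
    have "positive_operator (ru_extension j T)" and eq: "\<forall>a. ru_extension j T (j a) = T a"
      unfolding ru_extension_def by blast+
    then show "ru_extension j T \<in> K" using contractive_operator_extend[OF je T] by (simp add: K_def)
    show "F (ru_extension j T) = T" using eq by (simp add: F_def fun_eq_iff)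
  qed
  moreover have "convex P" unfolding P_def by (rule convex_positive_operators)
  ultimately have "T extreme_point_of F ` K \<longleftrightarrow> ru_extension j T extreme_point_of K"
    using extreme_point_of_linear_image_inj_on[of F P K "ru_extension j T"] KP by simp
  then show ?thesis unfolding image unfolding K_def .
qed

end
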